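(* If $K,L\in\mathcal S^n$ are star bodies in $\mathbb R^n$, $0\le i<n$ and $p\ge 1$, then $$B_{-p,i}(K,L)^{n-i}\ \ge\ B_i(K)^{n-i+p}\,B_i(L)^{-p},$$ with equality if and only if $K$ and $L$ have similar chord.
   Context: $S^{n-1}$ is the unit sphere of $\mathbb R^n$ and $dS$ is its spherical Lebesgue measure. For a compact set $K\subset\mathbb R^n$ that contains the origin and is star-shaped with respect to it, the radial function is $\rho(K,u)=\max\{c\ge 0: cu\in K\}$, $u\in S^{n-1}$. $K$ is a star body if $\rho(K,\cdot)$ is positive and continuous on $S^{n-1}$; $\mathcal S^n$ is the set of star bodies. The half chord of $K$ in direction $u$ is $d(K,u)=\tfrac12(\rho(K,u)+\rho(K,-u))$. $K$ and $L$ have similar chord if there is a constant $\lambda>0$ with $d(K,u)=\lambda d(L,u)$ for all $u\in S^{n-1}$. The chord integral is $B_i(K)=\frac1n\int_{S^{n-1}}d(K,u)^{n-i}\,dS(u)$. The $L_p$-mixed chord integral is $$B_{-p,i}(K,L)=\frac1n\int_{S^{n-1}}d(K,u)^{n-i+p}\,d(L,u)^{-p}\,dS(u).$$ *)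

theory Defs
  imports "HOL-Analysis.Analysis"
begin

text \<open>
  Spherical Lebesgue measure, by polar coordinates: the measure of a Borel set \<open>A\<close> of the unit
  sphere is \<open>n\<close> times the volume of the cone \<open>{x. 0 < norm x < 1 \<and> x /\<^sub>R norm x \<in> A}\<close>
  (see \<open>emeasure_sphere_measure\<close> below). For \<open>n = 1\<close> it is the counting measure on \<open>{-1, 1}\<close>.
\<close>

definition sphere_measure :: "(real ^ 'n) measure" where
  "sphere_measure = scale_measure (of_nat CARD('n))
     (distr (restrict_space lborel (ball 0 1 - {0})) (restrict_space borel (sphere 0 1))
       (\<lambda>x. x /\<^sub>R norm x))"

lemma measurable_sphere_projection:
  "(\<lambda>x :: real ^ 'n. x /\<^sub>R norm x)
     \<in> restrict_space lborel (ball 0 1 - {0}) \<rightarrow>\<^sub>M restrict_space borel (sphere 0 1)"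
  by (intro measurable_restrict_space2 measurable_restrict_space1)
     (auto simp: space_restrict_space)

lemma emeasure_sphere_measure:
  fixes A :: "(real ^ 'n) set"
  assumes "A \<in> sets borel" "A \<subseteq> sphere 0 1"
  shows "emeasure sphere_measure A =
    of_nat CARD('n) * emeasure lborel {x. 0 < norm x \<and> norm x < 1 \<and> x /\<^sub>R norm x \<in> A}"
proof -
  have A: "A \<in> sets (restrict_space borel (sphere 0 1))"
    using assms by (auto simp: sets_restrict_space_iff)
  have eq: "(\<lambda>x. x /\<^sub>R norm x) -` A \<inter> space (restrict_space lborel (ball 0 1 - {0})) =
      {x. 0 < norm x \<and> norm x < 1 \<and> x /\<^sub>R norm x \<in> A}"
    by (auto simp: space_restrict_space)
  show ?thesis
    unfolding sphere_measure_def emeasure_scale_measure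
      emeasure_distr[OF measurable_sphere_projection A] eq
    by (subst emeasure_restrict_space) auto
qed

definition radial :: "(real ^ 'n) set \<Rightarrow> real ^ 'n \<Rightarrow> real" where
  "radial K u = (GREATEST c. 0 \<le> c \<and> c *\<^sub>R u \<in> K)"

definition star_body :: "(real ^ 'n) set \<Rightarrow> bool" where
  "star_body K \<longleftrightarrow>
     compact K \<and> 0 \<in> K \<and> (\<forall>x\<in>K. closed_segment 0 x \<subseteq> K) \<and>
     (\<forall>u\<in>sphere 0 1. 0 < radial K u) \<and> continuous_on (sphere 0 1) (radial K)"

definition half_chord :: "(real ^ 'n) set \<Rightarrow> real ^ 'n \<Rightarrow> real" where
  "half_chord K u = (radial K u + radial K (- u)) / 2"

definition similar_chord :: "(real ^ 'n) set \<Rightarrow> (real ^ 'n) set \<Rightarrow> bool" where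
  "similar_chord K L \<longleftrightarrow> (\<exists>r>0. \<forall>u\<in>sphere 0 1. half_chord K u = r * half_chord L u)"

definition chord_integral :: "real \<Rightarrow> (real ^ 'n) set \<Rightarrow> real" where
  "chord_integral i K =
     1 / real CARD('n) * (LINT u|sphere_measure. half_chord K u powr (real CARD('n) - i))"

text \<open>The first argument is the \<open>p\<close> of \<open>B\<^bsub>-p,i\<^esub>(K, L)\<close>, not \<open>-p\<close>.\<close>

definition mixed_chord_integral ::
    "real \<Rightarrow> real \<Rightarrow> (real ^ 'n) set \<Rightarrow> (real ^ 'n) set \<Rightarrow> real" where
  "mixed_chord_integral p i K L =
     1 / real CARD('n) *
       (LINT u|sphere_measure.
          half_chord K u powr (real CARD('n) - i + p) * half_chord L u powr (- p))"

end

theory Submission imports Defs begin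

text \<open>
  With \<open>q = (n - i + p) / (n - i)\<close> the inequality reads
  \<open>(\<integral>u)\<^sup>q (\<integral>v)\<^bsup>1 - q\<^esup> \<le> \<integral>u\<^sup>q v\<^bsup>1 - q\<^esup>\<close> for \<open>u = d(K, -)\<^bsup>n - i\<^esup>\<close>
  and \<open>v = d(L, -)\<^bsup>n - i\<^esup>\<close>. Put \<open>t = u (\<integral>v) / (v (\<integral>u))\<close>, integrate the tangent inequality
  \<open>t\<^sup>q \<ge> 1 + q (t - 1)\<close> against \<open>v\<close>, and note that the linear term integrates to \<open>0\<close>.
  Equality in the tangent inequality forces \<open>t = 1\<close> almost everywhere, hence everywhere, since the
  half chords are continuous and nonempty open subsets of the sphere have positive measure.
\<close>

section \<open>Bernoulli's inequality for real exponents and its integrated form\<close>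

lemma powr_tangent_strict:
  fixes t q :: real
  assumes "0 < t" "t \<noteq> 1" "1 < q"
  shows "1 + q * (t - 1) < t powr q"
proof (cases "0 < 1 + q * (t - 1)")
  case True
  define y where "y = 1 + q * (t - 1)"
  have y: "0 < y" using True by (simp add: y_def)
  \<comment> \<open>The bound ln s <= s - 1 is used at \<open>y / t\<close> with weight 1 and at
    \<open>1 / t\<close> with weight \<open>q - 1\<close>. The right sides then cancel, because
    \<open>y + q - 1 = q * t\<close>, and the left sides add up to \<open>ln y - q * ln t\<close>.
    Strictness comes from the second bound, since \<open>t\<close> is not 1.\<close>
  have "ln (y / t) \<le> y / t - 1"
    using y assms by (intro ln_le_minus_one) auto
  moreover have "ln (1 / t) < 1 / t - 1"
    using ln_le_minus_one[of "1 / t"] ln_eq_minus_one[of "1 / t"] assms by fastforce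
  then have "(q - 1) * ln (1 / t) < (q - 1) * (1 / t - 1)"
    using assms by simp
  moreover have "y / t - 1 + (q - 1) * (1 / t - 1) = 0"
    using assms by (simp add: y_def field_simps)
  ultimately have "ln (y / t) + (q - 1) * ln (1 / t) < 0"
    by linarith
  then have "ln y < q * ln t"
    using y assms by (simp add: ln_div algebra_simps)
  then have "ln y < ln (t powr q)"
    using assms by (simp add: ln_powr)
  then have "y < t powr q"
    using y assms by (subst (asm) ln_less_cancel_iff) auto
  then show ?thesis
    by (simp add: y_def)
next
  case False
  then show ?thesis
    using assms(1) by (smt (verit) powr_gt_zero)
qed

lemma powr_tangent:
  fixes t q :: real
  assumes "0 < t" "1 < q"
  shows "1 + q * (t - 1) \<le> t powr q"
    and "t powr q = 1 + q * (t - 1) \<longleftrightarrow> t = 1"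
  using powr_tangent_strict[of t q] assms by (cases "t = 1"; auto)+

text \<open>A reverse Hoelder inequality: the exponents \<open>q\<close> and \<open>1 - q\<close>
  sum to 1, and the second one is negative, which turns the usual inequality around. Equality means
  that \<open>u\<close> and \<open>v\<close> are proportional almost everywhere.\<close>

lemma powr_integral_ratio:
  fixes u v :: "'a \<Rightarrow> real" and q :: real
  assumes int: "integrable M u" "integrable M v"
      "integrable M (\<lambda>x. u x powr q * v x powr (1 - q))"
    and pos: "\<And>x. x \<in> space M \<Longrightarrow> 0 < u x" "\<And>x. x \<in> space M \<Longrightarrow> 0 < v x"
    and ipos: "0 < integral\<^sup>L M u" "0 < integral\<^sup>L M v"
    and q: "1 < q"
  shows "integral\<^sup>L M u powr q * integral\<^sup>L M v powr (1 - q)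
           \<le> (LINT x|M. u x powr q * v x powr (1 - q))"
    and "(LINT x|M. u x powr q * v x powr (1 - q))
           = integral\<^sup>L M u powr q * integral\<^sup>L M v powr (1 - q)
         \<longleftrightarrow> (AE x in M. u x / integral\<^sup>L M u = v x / integral\<^sup>L M v)"
proof -
  define U V where "U = integral\<^sup>L M u" and "V = integral\<^sup>L M v"
  have UV: "0 < U" "0 < V" using ipos by (auto simp: U_def V_def)
  define c where "c = V / U"
  have c: "0 < c" using UV by (simp add: c_def)
  define t where "t x = c * (u x / v x)" for x
  \<comment> \<open>\<open>h\<close> is the gap in the tangent inequality, weighted by
    \<open>v\<close>. Its integral is a positive multiple of the difference of the two sides, so
    \<open>h\<close> being nonnegative gives the inequality and \<open>h\<close> vanishing almost
    everywhere is the equality case.\<close>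
  define h where "h x = v x * (t x powr q - (1 + q * (t x - 1)))" for x
  have t: "0 < t x" if "x \<in> space M" for x
    using pos that c by (simp add: t_def)
  have h_nonneg: "0 \<le> h x" if "x \<in> space M" for x
    using powr_tangent(1)[OF t[OF that] q] pos(2)[OF that] by (simp add: h_def)
  have h0: "h x = 0 \<longleftrightarrow> u x / U = v x / V" if "x \<in> space M" for x
  proof -
    have "h x = 0 \<longleftrightarrow> t x = 1"
      using powr_tangent(2)[OF t[OF that] q] pos(2)[OF that] by (auto simp: h_def)
    also have "\<dots> \<longleftrightarrow> u x / U = v x / V"
      using pos[OF that] UV by (auto simp: t_def c_def field_simps)
    finally show ?thesis .
  qed
  have h_eq: "h x = c powr q * (u x powr q * v x powr (1 - q)) - ((1 - q) * v x + q * c * u x)"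
    if "x \<in> space M" for x
  proof -
    have "v x * t x powr q = c powr q * (u x powr q * v x powr (1 - q))"
      using pos[OF that] c by (simp add: t_def powr_mult powr_divide powr_diff)
    moreover have "v x * t x = c * u x"
      using pos[OF that] by (simp add: t_def)
    ultimately show ?thesis
      by (simp add: h_def algebra_simps)
  qed
  let ?I = "LINT x|M. u x powr q * v x powr (1 - q)"
  have rhs_int: "integrable M
      (\<lambda>x. c powr q * (u x powr q * v x powr (1 - q)) - ((1 - q) * v x + q * c * u x))"
    using int by auto
  have h_int: "integrable M h"
    using rhs_int by (subst Bochner_Integration.integrable_cong[OF refl h_eq]) auto
  have "integral\<^sup>L M h = c powr q * ?I - ((1 - q) * V + q * c * U)"
    using int by (subst Bochner_Integration.integral_cong[OF refl h_eq]) (auto simp: U_def V_def)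
  also have "\<dots> = c powr q * ?I - V"
    using UV by (simp add: c_def algebra_simps)
  \<comment> \<open>Since \<open>c * U = V\<close>, the term \<open>V\<close> equals
    \<open>c powr q * U powr q * V powr (1 - q)\<close>.\<close>
  also have "\<dots> = c powr q * (?I - U powr q * V powr (1 - q))"
    using UV by (simp add: c_def powr_divide powr_diff right_diff_distrib)
  finally have I: "integral\<^sup>L M h = c powr q * (?I - U powr q * V powr (1 - q))" .
  have cq: "0 < c powr q" using c by simp
  have "0 \<le> integral\<^sup>L M h"
    using h_nonneg by (intro Bochner_Integration.integral_nonneg)
  then show "integral\<^sup>L M u powr q * integral\<^sup>L M v powr (1 - q) \<le> ?I"
    using cq unfolding I U_def V_def by (simp add: zero_le_mult_iff)
  have "integral\<^sup>L M h = 0 \<longleftrightarrow> (AE x in M. h x = 0)"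
    using h_int h_nonneg by (intro integral_nonneg_eq_0_iff_AE) auto
  also have "\<dots> \<longleftrightarrow> (AE x in M. u x / U = v x / V)"
    by (intro AE_cong) (auto simp: h0)
  finally show "?I = integral\<^sup>L M u powr q * integral\<^sup>L M v powr (1 - q)
      \<longleftrightarrow> (AE x in M. u x / integral\<^sup>L M u = v x / integral\<^sup>L M v)"
    using cq unfolding I U_def V_def by auto
qed

section \<open>Integration of continuous functions over the sphere\<close>

lemma space_sphere_measure [simp]: "space sphere_measure = sphere 0 1"
  by (simp add: sphere_measure_def space_scale_measure space_restrict_space)

lemma sets_sphere_measure [simp, measurable_cong]:
  "sets sphere_measure = sets (restrict_space borel (sphere 0 1))"
  by (simp add: sphere_measure_def)

lemma finite_measure_sphere_measure: "finite_measure (sphere_measure :: (real ^ 'n) measure)"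
proof
  have "emeasure lborel {x :: real ^ 'n. 0 < norm x \<and> norm x < 1 \<and> x /\<^sub>R norm x \<in> sphere 0 1}
      \<le> emeasure lborel (ball (0 :: real ^ 'n) 1)"
    by (intro emeasure_mono) auto
  also have "\<dots> < \<infinity>"
    by (intro emeasure_bounded_finite) auto
  finally show "emeasure sphere_measure (space (sphere_measure :: (real ^ 'n) measure)) \<noteq> \<infinity>"
    by (simp add: emeasure_sphere_measure ennreal_mult_eq_top_iff del: mem_sphere_0)
qed

text \<open>The cone over \<open>T\<close> inside the punctured unit ball is open, as the preimage
  of \<open>T\<close> under the continuous radial projection, and it contains
  \<open>u /\<^sub>R 2\<close>. A nonempty open set is not Lebesgue null.\<close>

lemma emeasure_sphere_measure_open_pos:
  fixes T :: "(real ^ 'n) set"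
  assumes "open T" and u: "u \<in> T" "norm u = 1"
  shows "emeasure sphere_measure (T \<inter> sphere 0 1) \<noteq> 0"
proof
  assume "emeasure sphere_measure (T \<inter> sphere 0 1) = 0"
  define C where "C = {x :: real ^ 'n. 0 < norm x \<and> norm x < 1 \<and> x /\<^sub>R norm x \<in> T \<inter> sphere 0 1}"
  have C_eq: "C = (\<lambda>x. x /\<^sub>R norm x) -` T \<inter> (ball 0 1 - {0})"
    by (auto simp: C_def)
  have "continuous_on (ball 0 1 - {0}) (\<lambda>x :: real ^ 'n. x /\<^sub>R norm x)"
    by (auto intro!: continuous_intros)
  then have "open C"
    unfolding C_eq using \<open>open T\<close>
    by (subst (asm) continuous_on_open_vimage) auto
  moreover have "u /\<^sub>R 2 \<in> C"
    using u by (auto simp: C_def)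
  moreover have "emeasure lborel C = 0"
    using \<open>emeasure sphere_measure (T \<inter> sphere 0 1) = 0\<close> \<open>open T\<close>
    by (subst (asm) emeasure_sphere_measure) (auto simp: C_def)
  then have "negligible C"
    using \<open>open C\<close> by (simp add: negligible_iff_null_sets null_sets_def)
  ultimately show False
    using open_not_negligible by blast
qed

text \<open>The set where two continuous functions differ is relatively open in the sphere, so it
  cannot be null unless it is empty.\<close>

lemma AE_sphere_measure_eq_iff:
  fixes f g :: "real ^ 'n \<Rightarrow> real"
  assumes f: "continuous_on (sphere 0 1) f" and g: "continuous_on (sphere 0 1) g"
  shows "(AE u in sphere_measure. f u = g u) \<longleftrightarrow> (\<forall>u\<in>sphere 0 1. f u = g u)"
proof
  assume AE: "AE u in sphere_measure. f u = g u"
  have "openin (top_of_set (sphere 0 1)) (sphere 0 1 \<inter> (\<lambda>u. f u - g u) -` (- {0}))"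
    by (intro continuous_openin_preimage_gen continuous_intros f g open_Compl closed_singleton)
  then obtain T where T: "open T" "sphere 0 1 \<inter> (\<lambda>u. f u - g u) -` (- {0}) = sphere 0 1 \<inter> T"
    by (auto simp: openin_open)
  then have T': "T \<inter> sphere 0 1 = {u \<in> space sphere_measure. f u \<noteq> g u}"
    by (simp add: set_eq_iff) blast
  have "T \<inter> sphere 0 1 \<in> sets sphere_measure"
    using T(1) by (auto simp: sets_restrict_space_iff)
  then have "emeasure sphere_measure (T \<inter> sphere 0 1) = 0"
    using AE AE_iff_measurable[OF _ T'[symmetric]] by blast
  then have "T \<inter> sphere 0 1 = {}"
    using emeasure_sphere_measure_open_pos[OF T(1)] by auto
  then show "\<forall>u\<in>sphere 0 1. f u = g u"
    unfolding T' by simp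
next
  assume "\<forall>u\<in>sphere 0 1. f u = g u"
  then show "AE u in sphere_measure. f u = g u"
    by (intro AE_I2) auto
qed

lemma integrable_sphere_measure:
  fixes f :: "real ^ 'n \<Rightarrow> real"
  assumes "continuous_on (sphere 0 1) f"
  shows "integrable sphere_measure f"
proof -
  interpret finite_measure "sphere_measure :: (real ^ 'n) measure"
    by (rule finite_measure_sphere_measure)
  obtain B where "\<And>u. u \<in> sphere 0 1 \<Longrightarrow> norm (f u) \<le> B"
    using compact_imp_bounded[OF compact_continuous_image[OF assms compact_sphere]]
    unfolding bounded_iff by blast
  moreover have "f \<in> borel_measurable sphere_measure"
    using borel_measurable_continuous_on_restrict[OF assms]
    by (simp cong: measurable_cong_sets)
  ultimately show ?thesis
    by (intro integrable_const_bound[where B = B] AE_I2) auto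
qed

text \<open>If the integral were 0, \<open>f\<close> would vanish almost everywhere and so, being
  continuous, everywhere. This contradicts positivity because the sphere has a point in every
  dimension.\<close>

lemma integral_sphere_measure_pos:
  fixes f :: "real ^ 'n \<Rightarrow> real"
  assumes f: "continuous_on (sphere 0 1) f" and pos: "\<And>u. u \<in> sphere 0 1 \<Longrightarrow> 0 < f u"
  shows "0 < integral\<^sup>L sphere_measure f"
proof -
  have "0 \<le> integral\<^sup>L sphere_measure f"
    using pos by (intro Bochner_Integration.integral_nonneg) (auto intro: less_imp_le)
  moreover have "integral\<^sup>L sphere_measure f \<noteq> 0"
  proof
    assume "integral\<^sup>L sphere_measure f = 0"
    then have "AE u in sphere_measure. f u = 0"
      using integrable_sphere_measure[OF f] pos
      by (subst (asm) integral_nonneg_eq_0_iff_AE) (auto intro!: AE_I2 less_imp_le)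
    then have "\<forall>u\<in>sphere 0 1. f u = 0"
      using AE_sphere_measure_eq_iff[OF f continuous_on_const] by blast
    moreover obtain u :: "real ^ 'n" where "norm u = 1"
      using vector_choose_size[of 1] by auto
    ultimately show False
      using pos[of u] by auto
  qed
  ultimately show ?thesis by simp
qed

section \<open>Half chords and the inequality for chord integrals\<close>

lemma half_chord_pos:
  assumes "star_body K" "u \<in> sphere 0 1"
  shows "0 < half_chord K u"
  using assms by (auto simp: star_body_def half_chord_def intro!: add_pos_pos)

lemma continuous_on_half_chord:
  assumes "star_body K"
  shows "continuous_on (sphere 0 1) (half_chord K)"
proof -
  have cont: "continuous_on (sphere 0 1) (radial K)"
    using assms by (simp add: star_body_def)
  have "continuous_on (sphere 0 1) (\<lambda>u. radial K (- u))"
    by (rule continuous_on_compose2[OF cont]) (auto intro!: continuous_intros)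
  then show ?thesis
    unfolding half_chord_def[abs_def] by (intro continuous_intros cont) auto
qed

theorem proposition2p2:
  fixes K L :: "(real ^ 'n) set" and i p :: real
  assumes "star_body K" and "star_body L"
    and "0 \<le> i" and "i < real CARD('n)" and "1 \<le> p"
  shows "mixed_chord_integral p i K L powr (real CARD('n) - i)
           \<ge> chord_integral i K powr (real CARD('n) - i + p) * chord_integral i L powr (- p)
       \<and> (mixed_chord_integral p i K L powr (real CARD('n) - i)
           = chord_integral i K powr (real CARD('n) - i + p) * chord_integral i L powr (- p)
         \<longleftrightarrow> similar_chord K L)"
proof -
  define n a q where "n = real CARD('n)" and "a = n - i" and "q = (a + p) / a"
  have n: "0 < n" and a: "0 < a" and q: "1 < q"
    using assms by (auto simp: n_def a_def q_def field_simps)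
  \<comment> \<open>These identities turn \<open>u x powr q * v x powr (1 - q)\<close> into the
    integrand of the mixed chord integral and, further down, \<open>R powr a\<close> into the
    right-hand side of the claim.\<close>
  have aq: "a * q = a + p" "a * (1 - q) = - p"
    using a by (auto simp: q_def field_simps)
  define u v where "u x = half_chord K x powr a" and "v x = half_chord L x powr a" for x
  note kpos = half_chord_pos[OF assms(1)] and lpos = half_chord_pos[OF assms(2)]
  have upos: "0 < u x" and vpos: "0 < v x" if "x \<in> sphere 0 1" for x
    using kpos[OF that] lpos[OF that] by (auto simp: u_def v_def)
  \<comment> \<open>Continuity of \<open>powr\<close> asks for a nonzero base, which positivity of
    the half chords supplies.\<close>
  have cu: "continuous_on (sphere 0 1) u" and cv: "continuous_on (sphere 0 1) v"
    unfolding u_def[abs_def] v_def[abs_def] using kpos lpos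
    by (auto intro!: continuous_on_powr continuous_on_half_chord assms continuous_on_const
        simp: less_le)
  have cw: "continuous_on (sphere 0 1) (\<lambda>x. u x powr q * v x powr (1 - q))"
    using upos vpos
    by (auto intro!: continuous_on_mult continuous_on_powr cu cv continuous_on_const
        simp: less_le)
  define U V W where "U = integral\<^sup>L sphere_measure u" and "V = integral\<^sup>L sphere_measure v"
    and "W = (LINT x|sphere_measure. u x powr q * v x powr (1 - q))"
  have U: "0 < U" and V: "0 < V"
    unfolding U_def V_def using upos vpos by (auto intro!: integral_sphere_measure_pos cu cv)
  have W: "0 < W"
    unfolding W_def using upos vpos
    by (intro integral_sphere_measure_pos cw) (auto simp: less_le)
  have ineq: "U powr q * V powr (1 - q) \<le> W"
    and eq: "W = U powr q * V powr (1 - q)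
      \<longleftrightarrow> (AE x in sphere_measure. u x / U = v x / V)"
    unfolding U_def V_def W_def
    using upos vpos U V q
    by (intro powr_integral_ratio integrable_sphere_measure cu cv cw; simp add: U_def V_def)+
  have "(AE x in sphere_measure. u x / U = v x / V)
      \<longleftrightarrow> (\<forall>x\<in>sphere 0 1. u x / U = v x / V)"
    using U V by (intro AE_sphere_measure_eq_iff continuous_intros cu cv) auto
  also have "\<dots> \<longleftrightarrow> similar_chord K L"
  proof
    assume *: "\<forall>x\<in>sphere 0 1. u x / U = v x / V"
    \<comment> \<open>The similarity factor is the \<open>a\<close>-th root of \<open>U / V\<close>,
      the ratio of \<open>u\<close> to \<open>v\<close>.\<close>
    have "half_chord K x = (U / V) powr (1 / a) * half_chord L x" if x: "x \<in> sphere 0 1" for x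
    proof -
      have "half_chord K x = u x powr (1 / a)"
        using kpos[OF x] a by (simp add: u_def powr_powr)
      also have "u x = U / V * v x"
        using * x U V by (simp add: field_simps)
      also have "\<dots> powr (1 / a) = (U / V) powr (1 / a) * half_chord L x"
        using lpos[OF x] a U V by (simp only: powr_mult) (simp add: v_def powr_powr)
      finally show ?thesis .
    qed
    then show "similar_chord K L"
      using U V unfolding similar_chord_def by (intro exI[of _ "(U / V) powr (1 / a)"]) auto
  next
    assume "similar_chord K L"
    then obtain r where r: "0 < r" "\<And>x. x \<in> sphere 0 1 \<Longrightarrow> half_chord K x = r * half_chord L x"
      by (auto simp: similar_chord_def)
    \<comment> \<open>The factor \<open>r powr a\<close> relates the functions \<open>u\<close>,
      \<open>v\<close> as well as their integrals \<open>U\<close>, \<open>V\<close>, so it cancels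
      in the normalised quotients.\<close>
    have uv: "u x = r powr a * v x" if "x \<in> sphere 0 1" for x
      using r lpos[OF that] that by (simp add: u_def v_def powr_mult)
    have "U = (LINT x|sphere_measure. r powr a * v x)"
      unfolding U_def by (intro Bochner_Integration.integral_cong) (auto simp: uv)
    then have "U = r powr a * V"
      by (simp add: V_def)
    then show "\<forall>x\<in>sphere 0 1. u x / U = v x / V"
      using r(1) by (auto simp: uv)
  qed
  finally have eq': "W = U powr q * V powr (1 - q) \<longleftrightarrow> similar_chord K L"
    using eq by simp
  have B: "chord_integral i K = U / n" "chord_integral i L = V / n"
    by (simp_all add: chord_integral_def U_def V_def u_def[abs_def] v_def[abs_def] n_def a_def)
  have M: "mixed_chord_integral p i K L = W / n"
    unfolding mixed_chord_integral_def W_def u_def v_def powr_powr aq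
    by (simp add: n_def a_def)
  \<comment> \<open>\<open>R\<close> is the lower bound for \<open>W / n\<close>. As the exponents
    sum to 1, the factors \<open>1 / n\<close> combine to a single \<open>1 / n\<close>, the one
    that stands in front of \<open>W\<close>.\<close>
  define R where "R = (U / n) powr q * (V / n) powr (1 - q)"
  have R: "R = U powr q * V powr (1 - q) / n"
    using U V n by (simp add: R_def powr_divide powr_diff)
  have R0: "0 < R" using U V n by (simp add: R_def)
  have Ra: "R powr a = (U / n) powr (a + p) * (V / n) powr (- p)"
    using U V n aq by (simp add: R_def powr_mult powr_powr mult.commute)
  have "R powr a \<le> (W / n) powr a"
    using ineq R0 n a by (intro powr_mono2) (auto simp: R divide_right_mono)
  \<comment> \<open>For \<open>a > 0\<close> the \<open>a\<close>-th power is strictly increasing on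
    positive reals, hence injective there, and the equality case survives the passage to
    \<open>a\<close>-th powers.\<close>
  moreover have "(W / n) powr a = R powr a \<longleftrightarrow> W = U powr q * V powr (1 - q)"
  proof -
    have "(W / n) powr a = R powr a \<longleftrightarrow> W / n = R"
      using W R0 n a powr_less_mono2[of a "W / n" R] powr_less_mono2[of a R "W / n"]
      by (cases "W / n" R rule: linorder_cases) auto
    then show ?thesis
      using n by (simp add: R)
  qed
  ultimately show ?thesis
    unfolding B M Ra eq' by (simp add: Ra n_def[symmetric] a_def[symmetric])
qed

end
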